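(* Let $A\in\mathbb{R}^{r\times n}$ have rank $r$, let $\varphi$ be a real-valued $C^2$ function on a neighborhood of $A\widehat X\subset\mathbb{R}^r$, and let $$f(x)=\varphi(Ax)+q(x),$$ where $q$ is a concave quadratic function on $\mathbb{R}^n$. If $\nabla^2\varphi(u)\preceq LI_r$ for all $u\in A\widehat X$, for some $L\ge0$, then $d^\star(f;X)\le r$. If, in addition, $\nabla^2f(z)$ has at least $r$ positive eigenvalues (counted with multiplicity) at some $z\in\widehat X$, then $d^\star(f;X)=r$.
   Context: $X\subset\mathbb{R}^n$ is compact and full dimensional (its affine hull is $\mathbb{R}^n$) and $\widehat X=\operatorname{conv}X$. $\preceq$ is the Loewner order. For a $C^2$ function $f$ on a neighborhood of $\widehat X$, $\mathcal{D}^2(f;X)$ is the set of pairs $(g,h)$ of functions that are $C^2$ on a neighborhood of $\widehat X$, satisfy $f=g-h$ there, and are convex on $\widehat X$ (equivalently, have positive semidefinite Hessians at every point of $\widehat X$). For a $C^2$ convex $g$: $V_X(g)=\operatorname{span}\bigl(\bigcup_{z\in\widehat X}\operatorname{range}\nabla^2g(z)\bigr)$, $d_X(g)=\dim V_X(g)$, and $d^\star(f;X)=\min_{(g,h)\in\mathcal{D}^2(f;X)}d_X(g)$. *)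

theory Defs
  imports "HOL-Analysis.Analysis" "HOL-Computational_Algebra.Polynomial"
begin

section \<open>Twice continuously differentiable functions\<close>

definition gradient :: "(real^'n \<Rightarrow> real) \<Rightarrow> real^'n \<Rightarrow> real^'n" where
  "gradient f x = (\<chi> i. frechet_derivative f (at x) (axis i 1))"

definition hessian :: "(real^'n \<Rightarrow> real) \<Rightarrow> real^'n \<Rightarrow> real^'n^'n" where
  "hessian f x = jacobian (gradient f) (at x)"

definition C2_on :: "(real^'n) set \<Rightarrow> (real^'n \<Rightarrow> real) \<Rightarrow> bool" where
  "C2_on U f \<longleftrightarrow> open U \<and> (\<forall>x\<in>U. f differentiable (at x))
     \<and> (\<forall>x\<in>U. gradient f differentiable (at x)) \<and> continuous_on U (hessian f)"

definition C2_near :: "(real^'n) set \<Rightarrow> (real^'n \<Rightarrow> real) \<Rightarrow> bool" where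
  "C2_near K f \<longleftrightarrow> (\<exists>U. K \<subseteq> U \<and> C2_on U f)"


section \<open>Symmetric matrices and quadratic functions\<close>

definition psd :: "real^'n^'n \<Rightarrow> bool" where
  "psd M \<longleftrightarrow> transpose M = M \<and> (\<forall>x. 0 \<le> x \<bullet> (M *v x))"

definition loewner_le :: "real^'n^'n \<Rightarrow> real^'n^'n \<Rightarrow> bool" (infix "\<preceq>\<^sub>L" 50) where
  "A \<preceq>\<^sub>L B \<longleftrightarrow> psd (B - A)"

definition charpoly :: "real^'n^'n \<Rightarrow> real poly" where
  "charpoly M = det (\<chi> i j. (if i = j then [:0, 1:] else 0) - [:M $ i $ j:])"

text \<open>The number of positive (real) eigenvalues, counted with algebraic multiplicity.\<close>

definition num_pos_eigenvalues :: "real^'n^'n \<Rightarrow> nat" where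
  "num_pos_eigenvalues M = (\<Sum>t | 0 < t \<and> poly (charpoly M) t = 0. order t (charpoly M))"

definition quadratic_function :: "(real^'n \<Rightarrow> real) \<Rightarrow> bool" where
  "quadratic_function q \<longleftrightarrow>
     (\<exists>(Q :: real^'n^'n) b c. transpose Q = Q \<and> (\<forall>x. q x = x \<bullet> (Q *v x) + b \<bullet> x + c))"


section \<open>Difference-of-convex decompositions\<close>

definition dc_decomps :: "(real^'n \<Rightarrow> real) \<Rightarrow> (real^'n) set
    \<Rightarrow> ((real^'n \<Rightarrow> real) \<times> (real^'n \<Rightarrow> real)) set" where
  "dc_decomps f X = {(g, h).
     (\<exists>U. convex hull X \<subseteq> U \<and> C2_on U g \<and> C2_on U h \<and> (\<forall>x\<in>U. f x = g x - h x))
     \<and> convex_on (convex hull X) g \<and> convex_on (convex hull X) h}"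

definition hess_space :: "(real^'n) set \<Rightarrow> (real^'n \<Rightarrow> real) \<Rightarrow> (real^'n) set" where
  "hess_space X g = span (\<Union>z \<in> convex hull X. range (\<lambda>v. hessian g z *v v))"

definition hess_dim :: "(real^'n) set \<Rightarrow> (real^'n \<Rightarrow> real) \<Rightarrow> nat" where
  "hess_dim X g = dim (hess_space X g)"

text \<open>All values of \<^const>\<open>hess_dim\<close> are at most the dimension of the space, so the set below is
  finite. \<^const>\<open>Min\<close> of the empty set is unspecified, so bounds on \<open>dstar\<close> entail a proof
  that a decomposition exists.\<close>

lemma finite_hess_dims:
  fixes X :: "(real^'n) set"
  shows "finite {hess_dim X g | g h. (g, h) \<in> dc_decomps f X}"
proof (rule finite_subset)
  show "{hess_dim X g | g h. (g, h) \<in> dc_decomps f X} \<subseteq> {..DIM(real^'n)}"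
    unfolding hess_dim_def using dim_subset_UNIV by blast
qed simp

definition dstar :: "(real^'n \<Rightarrow> real) \<Rightarrow> (real^'n) set \<Rightarrow> nat" where
  "dstar f X = Min {hess_dim X g | g h. (g, h) \<in> dc_decomps f X}"

end

theory Submission
  imports Defs
begin

text \<open>
  For the upper bound take \<open>g x = L / 2 * (norm (A x))\<^sup>2\<close> and \<open>h = g - f\<close>: the Hessian of \<open>g\<close> is
  \<open>L A\<^sup>T A\<close>, whose range lies in that of \<open>A\<^sup>T\<close>, and the Hessian of \<open>h\<close> is
  \<open>A\<^sup>T (L I - \<nabla>\<^sup>2\<phi>) A - \<nabla>\<^sup>2q\<close>, a sum of positive semidefinite matrices. For the lower bound, if \<open>f = g - h\<close> with
  \<open>h\<close> convex, then \<open>\<nabla>\<^sup>2g = \<nabla>\<^sup>2f + \<nabla>\<^sup>2h\<close> is positive definite on every subspace on which \<open>\<nabla>\<^sup>2f\<close> is, so it is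
  injective there. By the spectral theorem, the largest such subspace has as its dimension the number
  of positive eigenvalues of \<open>\<nabla>\<^sup>2f\<close>.
\<close>

section \<open>The spectral theorem and counting eigenvalues\<close>

text \<open>Maximize the Rayleigh quotient: if \<open>x\<close> attains the maximum \<open>c\<close>
  of \<open>f x \<bullet> x\<close> on the unit sphere of \<open>S\<close>, the symmetric form
  \<open>B\<close> is positive semidefinite on \<open>S\<close> and vanishes at
  \<open>(x, x)\<close>. As with Cauchy-Schwarz, \<open>x\<close> then lies in the radical of
  \<open>B\<close> on \<open>S\<close>, which makes it an eigenvector.\<close>

lemma selfadjoint_eigenvector_exists:
  fixes f :: "'a::euclidean_space \<Rightarrow> 'a"
  assumes "linear f" and sa: "\<And>x y. f x \<bullet> y = x \<bullet> f y"
    and S: "subspace S" "S \<noteq> {0}" and inv: "f ` S \<subseteq> S"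
  obtains x c where "x \<in> S" "norm x = 1" "f x = c *\<^sub>R x"
proof -
  interpret linear f by fact
  let ?K = "sphere 0 1 \<inter> S"
  obtain s where s: "s \<in> S" "s \<noteq> 0"
    using S subspace_0 by blast
  then have "s /\<^sub>R norm s \<in> ?K"
    using S by (simp add: subspace_scale)
  moreover have "compact ?K"
    using S(1) by (simp add: compact_Int_closed closed_subspace)
  moreover have "continuous_on ?K (\<lambda>x. f x \<bullet> x)"
    by (intro continuous_intros linear_continuous_on) (simp add: assms linear_conv_bounded_linear[symmetric])
  ultimately obtain x where x: "x \<in> ?K" and max: "\<And>y. y \<in> ?K \<Longrightarrow> f y \<bullet> y \<le> f x \<bullet> x"
    using continuous_attains_sup[of ?K "\<lambda>x. f x \<bullet> x"] by blast
  define c where "c = f x \<bullet> x"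
  have xS: "x \<in> S" and xx: "x \<bullet> x = 1"
    using x by (auto simp: norm_eq_1)
  define B where "B u v = c * (u \<bullet> v) - f u \<bullet> v" for u v
  have B_nonneg: "0 \<le> B y y" if "y \<in> S" for y
  proof (cases "y = 0")
    case False
    then have "y /\<^sub>R norm y \<in> ?K"
      using S that by (simp add: subspace_scale)
    then have "f (y /\<^sub>R norm y) \<bullet> (y /\<^sub>R norm y) \<le> c"
      unfolding c_def by (rule max)
    then have "(f y \<bullet> y) / (norm y)\<^sup>2 \<le> c"
      by (simp add: scale power2_eq_square field_simps)
    then show ?thesis
      using False by (simp add: B_def field_simps dot_square_norm)
  qed (simp add: B_def)
  have B_zero: "B x w = 0" if w: "w \<in> S" for w
  proof (rule ccontr)
    assume neq: "B x w \<noteq> 0"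
    define b k where "b = B x w" and "k = B w w"
    have k: "0 \<le> k" unfolding k_def using w by (rule B_nonneg)
    have quad: "B (x + t *\<^sub>R w) (x + t *\<^sub>R w) = 2 * t * b + t\<^sup>2 * k" for t
      using sa[of w x] xx
      by (simp add: B_def b_def k_def c_def add scale inner_add_left inner_add_right
          power2_eq_square algebra_simps inner_commute)
    have nonneg: "0 \<le> 2 * t * b + t\<^sup>2 * k" for t
      unfolding quad[symmetric]
      by (rule B_nonneg) (simp add: S(1) w xS subspace_add subspace_scale)
    \<comment> \<open>The choice t = -b / (k + 1) is close to the minimizer -b / k of the quadratic
      but also makes sense for k = 0. Multiplying by (k + 1) squared clears the
      denominators.\<close>
    have "0 \<le> (k + 1)\<^sup>2 * (2 * (- b / (k + 1)) * b + (- b / (k + 1))\<^sup>2 * k)"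
      by (intro mult_nonneg_nonneg nonneg) simp
    also have "\<dots> = - (b\<^sup>2 * (k + 2))"
    proof -
      have "(k + 1)\<^sup>2 * (2 * (- (b / (k + 1))) * b + (- (b / (k + 1)))\<^sup>2 * k)
          = - 2 * (k + 1) * b * ((k + 1) * (b / (k + 1))) + ((k + 1) * (b / (k + 1)))\<^sup>2 * k"
        by algebra
      also have "(k + 1) * (b / (k + 1)) = b" using k by simp
      finally show ?thesis by (simp add: algebra_simps power2_eq_square)
    qed
    also have "\<dots> < 0"
      using neq k by (simp add: b_def)
    finally show False by simp
  qed
  \<comment> \<open>Since \<open>B x w\<close> is the inner product of
    \<open>c *\<^sub>R x - f x\<close> with \<open>w\<close>, testing with this vector itself shows
    that its norm is zero; invariance of \<open>S\<close> makes it admissible.\<close>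
  have "c *\<^sub>R x - f x \<in> S"
    using S(1) xS inv by (simp add: image_subset_iff subspace_diff subspace_scale)
  from B_zero[OF this] have "(c *\<^sub>R x - f x) \<bullet> (c *\<^sub>R x - f x) = 0"
    by (simp add: B_def inner_diff_left inner_diff_right inner_commute algebra_simps)
  then have "f x = c *\<^sub>R x" by simp
  with xS x show ?thesis by (intro that) auto
qed

text \<open>Split off one eigenvector and recurse on its orthogonal complement in \<open>S\<close>,
  which is invariant because \<open>f\<close> is self-adjoint. Working with invariant subspaces
  keeps the complement within the same type.\<close>

theorem selfadjoint_orthonormal_eigenbasis:
  fixes f :: "'a::euclidean_space \<Rightarrow> 'a"
  assumes f: "linear f" and sa: "\<And>x y. f x \<bullet> y = x \<bullet> f y"
    and "subspace S" "f ` S \<subseteq> S"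
  shows "\<exists>B. B \<subseteq> S \<and> finite B \<and> card B = dim S \<and> pairwise orthogonal B
    \<and> (\<forall>b\<in>B. norm b = 1 \<and> (\<exists>c. f b = c *\<^sub>R b))"
  using assms(3,4)
proof (induction "dim S" arbitrary: S)
  case 0
  then show ?case by (intro exI[of _ "{}"]) simp
next
  case (Suc n)
  then have "S \<noteq> {0}" by auto
  then obtain x c where x: "x \<in> S" "norm x = 1" "f x = c *\<^sub>R x"
    using selfadjoint_eigenvector_exists[OF f sa Suc.prems(1) _ Suc.prems(2)] by blast
  define T where "T = {y \<in> S. orthogonal x y}"
  have "dim {y \<in> S. \<forall>z\<in>span {x}. orthogonal z y} + dim (span {x}) = dim S"
    using x(1) Suc.prems(1) by (intro dim_subspace_orthogonal_to_vectors) (auto simp: span_minimal)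
  moreover have "{y \<in> S. \<forall>z\<in>span {x}. orthogonal z y} = T"
    by (auto simp: T_def span_singleton orthogonal_def intro: exI[of _ 1])
  moreover have "dim (span {x}) = 1"
    using x(2) by (auto simp: dim_singleton)
  ultimately have dimT: "dim S = Suc (dim T)" by simp
  have "subspace T"
    unfolding T_def using Suc.prems(1)
    by (simp add: subspace_def orthogonal_def inner_add_right)
  moreover have "f ` T \<subseteq> T"
    using Suc.prems(2) x(3) by (auto simp: T_def orthogonal_def sa[symmetric])
  ultimately obtain B where B: "B \<subseteq> T" "finite B" "card B = dim T" "pairwise orthogonal B"
      "\<And>b. b \<in> B \<Longrightarrow> norm b = 1 \<and> (\<exists>c. f b = c *\<^sub>R b)"
    using Suc.hyps(1)[of T] Suc.hyps(2) dimT by auto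
  have "x \<notin> B" using B(1) x(2) by (auto simp: T_def orthogonal_def)
  moreover have "pairwise orthogonal (insert x B)"
    using B(1,4) by (auto simp: pairwise_insert T_def orthogonal_commute)
  ultimately show ?case
    using B x dimT by (intro exI[of _ "insert x B"]) (auto simp: T_def)
qed

section \<open>Orthogonal diagonalization of symmetric matrices\<close>

definition diagonal_matrix :: "('n \<Rightarrow> 'a::zero) \<Rightarrow> 'a^'n^'n" where
  "diagonal_matrix d = (\<chi> i j. if i = j then d i else 0)"

lemma matrix_mul_diagonal_matrix:
  fixes P :: "'a::comm_semiring_1^'n^'m"
  shows "(P ** diagonal_matrix d) $ i $ j = P $ i $ j * d j"
  by (simp add: diagonal_matrix_def matrix_matrix_mult_def if_distrib[of "\<lambda>x. _ * x"] cong: if_cong)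

lemma diagonal_matrix_mul_matrix:
  fixes P :: "'a::comm_semiring_1^'m^'n"
  shows "(diagonal_matrix d ** P) $ i $ j = d i * P $ i $ j"
  by (simp add: diagonal_matrix_def matrix_matrix_mult_def if_distrib[of "\<lambda>x. x * _"] cong: if_cong)

lemma diagonal_matrix_mul_vector:
  fixes v :: "'a::comm_semiring_1^'n"
  shows "(diagonal_matrix d *v v) $ i = d i * v $ i"
  by (simp add: diagonal_matrix_def matrix_vector_mult_def if_distrib[of "\<lambda>x. x * _"] cong: if_cong)

text \<open>The columns of \<open>P\<close> are the orthonormal eigenvectors, indexed through a
  bijection with the index type; column by column, the matrix identity is the eigenvector
  equation.\<close>

theorem symmetric_matrix_diagonalizable:
  fixes M :: "real^'n^'n"
  assumes "transpose M = M"
  obtains P d where "orthogonal_matrix P" "M ** P = P ** diagonal_matrix d"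
proof -
  have "(M *v x) \<bullet> y = x \<bullet> (M *v y)" for x y
    by (metis assms dot_lmul_matrix inner_commute transpose_matrix_vector)
  then obtain B where B: "finite B" "card B = CARD('n)" "pairwise orthogonal B"
      "\<And>b. b \<in> B \<Longrightarrow> norm b = 1 \<and> (\<exists>c. M *v b = c *\<^sub>R b)"
    using selfadjoint_orthonormal_eigenbasis[of "(*v) M" UNIV] by auto
  obtain b :: "'n \<Rightarrow> _" where b: "bij_betw b UNIV B"
    using finite_same_card_bij[of "UNIV :: 'n set" B] B(1,2) by auto
  have "\<forall>i. \<exists>c. M *v b i = c *\<^sub>R b i"
    using b B(4) by (auto simp: bij_betw_def)
  then obtain d where d: "\<And>i. M *v b i = d i *\<^sub>R b i" by metis
  define P where "P = (\<chi> i j. b j $ i)"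
  have col: "column j P = b j" for j
    by (simp add: column_def P_def vec_eq_iff)
  have "orthogonal_matrix P"
    unfolding orthogonal_matrix_orthonormal_columns col
    using b B(3,4) by (auto simp: bij_betw_def pairwise_def inj_def) metis
  moreover have "(M ** P) $ i $ j = (P ** diagonal_matrix d) $ i $ j" for i j
  proof -
    have "(M ** P) $ i $ j = (M *v b j) $ i"
      by (simp add: P_def matrix_matrix_mult_def matrix_vector_mult_def)
    then show ?thesis
      by (simp add: d matrix_mul_diagonal_matrix P_def)
  qed
  then have "M ** P = P ** diagonal_matrix d" by (simp add: vec_eq_iff)
  ultimately show ?thesis by (rule that)
qed

section \<open>Characteristic polynomials and the count of positive eigenvalues\<close>

text \<open>Embeds scalar matrices into matrices over the polynomial ring, where
  \<open>charpoly\<close> is a determinant and multiplicativity of \<open>det\<close> can be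
  applied.\<close>

definition const_poly_matrix :: "'a::comm_ring_1^'n^'m \<Rightarrow> 'a poly^'n^'m" where
  "const_poly_matrix M = (\<chi> i j. [:M $ i $ j:])"

lemma const_poly_matrix_mul:
  fixes A :: "'a::comm_ring_1^'n^'m"
  shows "const_poly_matrix (A ** B) = const_poly_matrix A ** const_poly_matrix B"
proof -
  have "(\<Sum>k\<in>S. [:f k:]) = [:sum f S:]" for f :: "'n \<Rightarrow> 'a" and S
    by (induction S rule: infinite_finite_induct) auto
  then show ?thesis
    by (simp add: const_poly_matrix_def matrix_matrix_mult_def vec_eq_iff mult.commute)
qed

lemma matrix_diff_ldistrib: "A ** (B - C) = A ** B - A ** C" for A :: "'a::ring_1^'n^'m"
  by (simp add: vec_eq_iff matrix_matrix_mult_def algebra_simps sum_subtractf)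

lemma matrix_diff_rdistrib: "(B - C) ** A = B ** A - C ** A" for A :: "'a::ring_1^'n^'m"
  by (simp add: vec_eq_iff matrix_matrix_mult_def algebra_simps sum_subtractf)

lemma const_poly_matrix_mat_1: "const_poly_matrix (mat 1) = mat 1"
  by (simp add: const_poly_matrix_def mat_def vec_eq_iff)

lemma charpoly_altdef: "charpoly M = det (diagonal_matrix (\<lambda>_. [:0, 1:]) - const_poly_matrix M)"
  unfolding charpoly_def
  by (rule arg_cong[of _ _ det]) (simp add: vec_eq_iff diagonal_matrix_def const_poly_matrix_def)

lemma charpoly_diagonal_matrix: "charpoly (diagonal_matrix d) = (\<Prod>i\<in>UNIV. [:- d i, 1:])"
  unfolding charpoly_def by (subst det_diagonal) (auto simp: diagonal_matrix_def)

text \<open>The scalar matrix of the indeterminate commutes with \<open>P\<close>, so (X - M) P = P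
  (X - N). Taking determinants, det P cancels: polynomials form an integral domain, and det P is
  nonzero because its product with the determinant of the transpose is 1.\<close>

lemma charpoly_similar:
  assumes P: "orthogonal_matrix P" and MP: "M ** P = P ** N"
  shows "charpoly M = charpoly N"
proof -
  let ?X = "diagonal_matrix (\<lambda>_. [:0, 1:])" and ?K = const_poly_matrix
  have "?X ** ?K P = ?K P ** ?X"
    by (simp add: vec_eq_iff diagonal_matrix_mul_matrix matrix_mul_diagonal_matrix)
  then have "(?X - ?K M) ** ?K P = ?K P ** (?X - ?K N)"
    using MP const_poly_matrix_mul[of M P] const_poly_matrix_mul[of P N]
    by (simp add: matrix_diff_ldistrib matrix_diff_rdistrib)
  then have "charpoly M * det (?K P) = det (?K P) * charpoly N"
    unfolding charpoly_altdef by (metis det_mul)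
  moreover have "det (?K (transpose P)) * det (?K P) = 1"
    using P by (simp add: det_mul[symmetric] const_poly_matrix_mul[symmetric]
        orthogonal_matrix const_poly_matrix_mat_1)
  then have "det (?K P) \<noteq> 0" by auto
  ultimately show ?thesis by simp
qed

lemma order_prod_linear:
  fixes d :: "'i \<Rightarrow> 'a::idom"
  assumes "finite I"
  shows "order t (\<Prod>i\<in>I. [:- d i, 1:]) = card {i \<in> I. d i = t}"
  using assms
proof (induction I)
  case (insert i I)
  have nz: "[:- d i, 1:] * (\<Prod>i\<in>I. [:- d i, 1:]) \<noteq> 0"
    using insert.hyps by (simp del: mult_pCons_left)
  have "order t [:- d i, 1:] = (if d i = t then 1 else 0)"
    using order_power_n_n[of t 1] by (auto intro!: order_0I)
  moreover have "{j \<in> insert i I. d j = t} =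
      (if d i = t then insert i {j \<in> I. d j = t} else {j \<in> I. d j = t})"
    by auto
  ultimately show ?case
    using insert order_mult[OF nz, of t] by simp
qed simp

text \<open>The multiplicity of a root \<open>t\<close> is the size of the fibre of \<open>d\<close>
  over \<open>t\<close>. For positive \<open>t\<close> this fibre lies within the indices with
  positive \<open>d\<close>, so the sum over the distinct roots counts those indices grouped by
  value.\<close>

lemma num_pos_eigenvalues_diagonalized:
  assumes "orthogonal_matrix P" "M ** P = P ** diagonal_matrix d"
  shows "num_pos_eigenvalues M = card {i. 0 < d i}"
proof -
  have cp: "charpoly M = (\<Prod>i\<in>UNIV. [:- d i, 1:])"
    using charpoly_similar[OF assms] by (simp add: charpoly_diagonal_matrix)
  let ?I = "{i. 0 < d i}"
  have "{t. 0 < t \<and> poly (charpoly M) t = 0} = d ` ?I"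
    by (auto simp: cp poly_prod)
  then have "num_pos_eigenvalues M = (\<Sum>t\<in>d ` ?I. card {i. d i = t})"
    by (simp add: num_pos_eigenvalues_def cp order_prod_linear)
  also have "\<dots> = (\<Sum>t\<in>d ` ?I. \<Sum>i | i \<in> ?I \<and> d i = t. 1)"
    by (intro sum.cong refl) (auto intro!: arg_cong[of _ _ card])
  also have "\<dots> = card ?I"
    by (subst sum.image_gen[of ?I "\<lambda>_. 1" d, symmetric]) auto
  finally show ?thesis .
qed

text \<open>\<open>W\<close> is the span of the eigenvectors with positive eigenvalue, obtained as
  the image under \<open>P\<close> of a coordinate subspace \<open>Y\<close>. As \<open>P\<close> is
  an isometry, the form at \<open>P *v y\<close> is the sum of the
  \<open>d i * (y $ i)\<^sup>2\<close>.\<close>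

theorem symmetric_matrix_positive_subspace:
  fixes M :: "real^'n^'n"
  assumes "transpose M = M"
  obtains W where "subspace W" "dim W = num_pos_eigenvalues M"
    "\<And>x. x \<in> W \<Longrightarrow> x \<noteq> 0 \<Longrightarrow> 0 < x \<bullet> (M *v x)"
proof -
  obtain P d where P: "orthogonal_matrix P" and MP: "M ** P = P ** diagonal_matrix d"
    using symmetric_matrix_diagonalizable[OF assms] .
  define Y where "Y = {y :: real^'n. \<forall>i. i \<notin> {i. 0 < d i} \<longrightarrow> y $ i = 0}"
  have Y: "subspace Y"
    by (auto simp: Y_def subspace_def)
  have dimY: "dim Y = card {i. 0 < d i}"
    unfolding dim_vec_eq[symmetric] Y_def by (rule dim_substandard_cart)
  have iso: "(P *v x) \<bullet> (P *v y) = x \<bullet> y" for x y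
  proof -
    have "(P *v x) \<bullet> (P *v y) = (transpose P *v (P *v x)) \<bullet> y"
      by (simp add: dot_lmul_matrix)
    also have "transpose P *v (P *v x) = x"
      using P by (simp only: matrix_vector_mul_assoc orthogonal_matrix matrix_vector_mul_lid)
    finally show ?thesis .
  qed
  have inj: "inj ((*v) P)"
    using P by (metis matrix_left_invertible_injective orthogonal_matrix)
  show ?thesis
  proof (rule that[of "(*v) P ` Y"])
    show "subspace ((*v) P ` Y)"
      using Y by (simp add: linear_subspace_image)
    show "dim ((*v) P ` Y) = num_pos_eigenvalues M"
      using num_pos_eigenvalues_diagonalized[OF P MP] dimY
      by (simp add: dim_image_eq inj_on_subset[OF inj])
    fix x assume "x \<in> (*v) P ` Y" "x \<noteq> 0"
    then obtain y where y: "x = P *v y" "y \<in> Y" "y \<noteq> 0" by force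
    have "x \<bullet> (M *v x) = (P *v y) \<bullet> (P *v (diagonal_matrix d *v y))"
      by (simp add: y(1) matrix_vector_mul_assoc MP)
    also have "\<dots> = (\<Sum>i\<in>UNIV. d i * (y $ i)\<^sup>2)"
      unfolding iso by (simp add: inner_vec_def diagonal_matrix_mul_vector power2_eq_square mult_ac)
    also have "0 < \<dots>"
    proof -
      obtain i where "y $ i \<noteq> 0" using y(3) by (auto simp: vec_eq_iff)
      moreover from this have "0 < d i" using y(2) by (auto simp: Y_def)
      ultimately show ?thesis
        using y(2) by (intro sum_pos2[of _ i]) (auto simp: Y_def zero_le_mult_iff not_less)
    qed
    finally show "0 < x \<bullet> (M *v x)" .
  qed
qed

section \<open>Second-order calculus and convexity\<close>

lemma C2_on_has_derivative:
  assumes "C2_on U f" "x \<in> U"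
  shows "(f has_derivative (\<lambda>v. gradient f x \<bullet> v)) (at x)"
    and "(gradient f has_derivative (\<lambda>v. hessian f x *v v)) (at x)"
proof -
  have f: "(f has_derivative frechet_derivative f (at x)) (at x)"
    using assms by (simp add: C2_on_def frechet_derivative_works)
  interpret linear "frechet_derivative f (at x)"
    using f by (rule has_derivative_linear)
  have "frechet_derivative f (at x) = (\<lambda>v. gradient f x \<bullet> v)"
  proof
    fix v
    have "frechet_derivative f (at x) (\<Sum>i\<in>UNIV. v $ i *\<^sub>R axis i 1) = gradient f x \<bullet> v"
      by (simp add: sum scale gradient_def inner_vec_def mult.commute)
    then show "frechet_derivative f (at x) v = gradient f x \<bullet> v"
      using basis_expansion[of v] by (simp add: scalar_mult_eq_scaleR)
  qed
  then show "(f has_derivative (\<lambda>v. gradient f x \<bullet> v)) (at x)"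
    using f by (simp only:)
  show "(gradient f has_derivative (\<lambda>v. hessian f x *v v)) (at x)"
    using assms by (simp add: C2_on_def hessian_def flip: jacobian_works)
qed

text \<open>Uniqueness of the derivative identifies \<open>G\<close> with the gradient on
  \<open>U\<close>; since \<open>U\<close> is open, the derivative of \<open>G\<close> is then also
  that of the gradient. Regularity and the Hessian formula come together, so each closure rule below
  needs one proof only.\<close>

lemma C2_on_and_hessianI:
  fixes G :: "real^'n \<Rightarrow> real^'n"
  assumes U: "open U"
    and f: "\<And>x. x \<in> U \<Longrightarrow> (f has_derivative (\<lambda>v. G x \<bullet> v)) (at x)"
    and G: "\<And>x. x \<in> U \<Longrightarrow> (G has_derivative (\<lambda>v. H x *v v)) (at x)"
    and H: "continuous_on U H"
  shows "C2_on U f \<and> (\<forall>x\<in>U. hessian f x = H x)"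
proof -
  have G_eq: "gradient f x = G x" if "x \<in> U" for x
    by (simp add: gradient_def frechet_derivative_at[OF f[OF that], symmetric] inner_axis
        vec_eq_iff)
  have gr: "(gradient f has_derivative (\<lambda>v. H x *v v)) (at x)" if "x \<in> U" for x
    by (rule has_derivative_transform_within_open[OF G[OF that] U that]) (simp add: G_eq)
  have hess: "hessian f x = H x" if "x \<in> U" for x
    by (simp add: hessian_def jacobian_def frechet_derivative_at[OF gr[OF that], symmetric])
  then show ?thesis
    using U f gr H unfolding C2_on_def
    by (auto simp: differentiable_def cong: continuous_on_cong)
qed

lemma C2_on_add:
  assumes f: "C2_on U f" and g: "C2_on U g"
  shows "C2_on U (\<lambda>x. f x + g x) \<and> (\<forall>x\<in>U. hessian (\<lambda>x. f x + g x) x = hessian f x + hessian g x)"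
proof (rule C2_on_and_hessianI)
  fix x assume x: "x \<in> U"
  note f' = C2_on_has_derivative[OF f x] and g' = C2_on_has_derivative[OF g x]
  show "((\<lambda>x. f x + g x) has_derivative (\<lambda>v. (gradient f x + gradient g x) \<bullet> v)) (at x)"
    using has_derivative_add[OF f'(1) g'(1)] by (simp add: inner_add_left)
  show "((\<lambda>x. gradient f x + gradient g x) has_derivative (\<lambda>v. (hessian f x + hessian g x) *v v)) (at x)"
    using has_derivative_add[OF f'(2) g'(2)] by (simp add: matrix_vector_mult_add_rdistrib)
qed (use f g in \<open>auto simp: C2_on_def intro!: continuous_intros\<close>)

lemma C2_on_diff:
  assumes f: "C2_on U f" and g: "C2_on U g"
  shows "C2_on U (\<lambda>x. f x - g x) \<and> (\<forall>x\<in>U. hessian (\<lambda>x. f x - g x) x = hessian f x - hessian g x)"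
proof (rule C2_on_and_hessianI)
  fix x assume x: "x \<in> U"
  note f' = C2_on_has_derivative[OF f x] and g' = C2_on_has_derivative[OF g x]
  show "((\<lambda>x. f x - g x) has_derivative (\<lambda>v. (gradient f x - gradient g x) \<bullet> v)) (at x)"
    using has_derivative_diff[OF f'(1) g'(1)] by (simp add: inner_diff_left)
  show "((\<lambda>x. gradient f x - gradient g x) has_derivative (\<lambda>v. (hessian f x - hessian g x) *v v)) (at x)"
    using has_derivative_diff[OF f'(2) g'(2)] by (simp add: matrix_vector_mult_diff_rdistrib)
qed (use f g in \<open>auto simp: C2_on_def intro!: continuous_intros\<close>)

text \<open>The product rule gives two terms, which symmetry of \<open>Q\<close> merges into one;
  hence the factor 2.\<close>

lemma C2_on_quadratic:
  fixes Q :: "real^'n^'n"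
  assumes Q: "transpose Q = Q"
  shows "C2_on UNIV (\<lambda>x. x \<bullet> (Q *v x) + b \<bullet> x + c)
    \<and> (\<forall>x\<in>UNIV. hessian (\<lambda>x. x \<bullet> (Q *v x) + b \<bullet> x + c) x = 2 *\<^sub>R Q)"
proof (rule C2_on_and_hessianI)
  have "(Q *v x) \<bullet> v = x \<bullet> (Q *v v)" for x v
    by (metis Q dot_lmul_matrix transpose_matrix_vector)
  then show "((\<lambda>x. x \<bullet> (Q *v x) + b \<bullet> x + c) has_derivative (\<lambda>v. (2 *\<^sub>R (Q *v x) + b) \<bullet> v)) (at x)" for x
    by (auto intro!: derivative_eq_intros bounded_linear_imp_has_derivative
        simp: inner_add_left inner_add_right inner_commute)
  show "((\<lambda>x. 2 *\<^sub>R (Q *v x) + b) has_derivative (\<lambda>v. (2 *\<^sub>R Q) *v v)) (at x)" for x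
    by (auto intro!: derivative_eq_intros bounded_linear_imp_has_derivative
        simp: scaleR_matrix_vector_assoc)
qed auto

lemma continuous_on_matrix_mult:
  fixes F :: "'a::topological_space \<Rightarrow> real^'n^'m" and G :: "'a \<Rightarrow> real^'k^'n"
  assumes "continuous_on S F" "continuous_on S G"
  shows "continuous_on S (\<lambda>x. F x ** G x)"
  unfolding matrix_matrix_mult_def
  by (intro continuous_intros continuous_on_vec_lambda assms continuous_on_component)

lemma C2_on_compose_linear:
  fixes A :: "real^'n^'r"
  assumes \<phi>: "C2_on V \<phi>"
  defines "U \<equiv> (\<lambda>x. A *v x) -` V"
  shows "C2_on U (\<lambda>x. \<phi> (A *v x))
    \<and> (\<forall>x\<in>U. hessian (\<lambda>x. \<phi> (A *v x)) x = transpose A ** (hessian \<phi> (A *v x) ** A))"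
proof (rule C2_on_and_hessianI)
  have A: "((*v) A has_derivative (*v) A) (at x)" for x
    by (auto intro!: bounded_linear_imp_has_derivative)
  have cont: "continuous_on S ((*v) A)" for S
    by (simp add: linear_continuous_on)
  show "open U"
    unfolding U_def using \<phi> by (intro open_vimage cont) (simp add: C2_on_def)
  fix x assume "x \<in> U"
  then have x: "A *v x \<in> V" by (simp add: U_def)
  note \<phi>' = C2_on_has_derivative[OF \<phi> x]
  show "((\<lambda>x. \<phi> (A *v x)) has_derivative (\<lambda>v. (transpose A *v gradient \<phi> (A *v x)) \<bullet> v)) (at x)"
    using has_derivative_compose[OF A \<phi>'(1)] by (simp add: dot_lmul_matrix)
  have "bounded_linear ((*v) (transpose A))" by simp
  from bounded_linear.has_derivative[OF this has_derivative_compose[OF A \<phi>'(2)]]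
  show "((\<lambda>x. transpose A *v gradient \<phi> (A *v x)) has_derivative
      (\<lambda>v. (transpose A ** (hessian \<phi> (A *v x) ** A)) *v v)) (at x)"
    by (simp only: matrix_vector_mul_assoc)
next
  have "continuous_on U (\<lambda>x. hessian \<phi> (A *v x))"
  proof (rule continuous_on_compose2[where g = "hessian \<phi>" and f = "(*v) A"])
    show "continuous_on V (hessian \<phi>)" using \<phi> by (simp add: C2_on_def)
    show "continuous_on U ((*v) A)" by (simp add: linear_continuous_on)
    show "(*v) A ` U \<subseteq> V" by (auto simp: U_def)
  qed
  then show "continuous_on U (\<lambda>x. transpose A ** (hessian \<phi> (A *v x) ** A))"
    by (intro continuous_on_matrix_mult continuous_on_const)
qed

section \<open>Convexity and the sign of the Hessian\<close>

lemma C2_on_DERIV_along_line: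
  assumes "C2_on U f" "z + t *\<^sub>R v \<in> U"
  shows "((\<lambda>t. f (z + t *\<^sub>R v)) has_real_derivative gradient f (z + t *\<^sub>R v) \<bullet> v) (at t)"
    and "((\<lambda>t. gradient f (z + t *\<^sub>R v) \<bullet> v) has_real_derivative
      v \<bullet> (hessian f (z + t *\<^sub>R v) *v v)) (at t)"
proof -
  note f' = C2_on_has_derivative[OF assms]
  have line: "((\<lambda>t. z + t *\<^sub>R v) has_derivative (\<lambda>s. s *\<^sub>R v)) (at t)"
    by (auto intro!: derivative_eq_intros)
  show "((\<lambda>t. f (z + t *\<^sub>R v)) has_real_derivative gradient f (z + t *\<^sub>R v) \<bullet> v) (at t)"
    using has_derivative_compose[OF line f'(1)]
    by (simp add: has_field_derivative_def mult_commute_abs)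
  show "((\<lambda>t. gradient f (z + t *\<^sub>R v) \<bullet> v) has_real_derivative
      v \<bullet> (hessian f (z + t *\<^sub>R v) *v v)) (at t)"
    using has_derivative_inner_left[OF has_derivative_compose[OF line f'(2)], of v]
    by (simp add: has_field_derivative_def mult_commute_abs inner_commute matrix_scaleR_vector_ac
        flip: scaleR_matrix_vector_assoc)
qed

text \<open>Along each segment in \<open>S\<close>, the Hessian form in the direction of the segment
  is the second derivative, so the one-variable criterion on the unit interval applies.\<close>

lemma convex_on_if_hessian_nonneg:
  assumes f: "C2_on U f" and S: "convex S" "S \<subseteq> U"
    and nonneg: "\<And>z v. z \<in> S \<Longrightarrow> 0 \<le> v \<bullet> (hessian f z *v v)"
  shows "convex_on S f"
proof (rule convex_onI[OF _ S(1)])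
  fix t x y assume t: "0 < t" "t < (1::real)" and xy: "x \<in> S" "y \<in> S"
  have S_line: "x + s *\<^sub>R (y - x) \<in> S" if "s \<in> {0..1}" for s
    using convexD_alt[OF S(1) xy, of s] that by (simp add: algebra_simps)
  have "convex_on {0..1} (\<lambda>s. f (x + s *\<^sub>R (y - x)))"
    using S_line S(2)
    by (intro f''_ge0_imp_convex[OF _ C2_on_DERIV_along_line[OF f]] nonneg) auto
  from convex_onD[OF this, of t 0 1] t
  show "f ((1 - t) *\<^sub>R x + t *\<^sub>R y) \<le> (1 - t) * f x + t * f y"
    by (simp add: algebra_simps)
qed

text \<open>Around an interior point, every direction gives a convex function \<open>p\<close> of
  one variable on a whole interval about 0. Its derivative is increasing, so the second derivative
  at 0 is nonnegative.\<close>

lemma convex_on_hessian_nonneg_interior: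
  assumes f: "C2_on U f" and S: "convex_on S f" "S \<subseteq> U" and z: "z \<in> interior S"
  shows "0 \<le> v \<bullet> (hessian f z *v v)"
proof -
  define I where "I = (\<lambda>t. z + t *\<^sub>R v) -` interior S"
  have "open I"
    unfolding I_def by (intro open_vimage) (auto intro!: continuous_intros)
  then obtain e where e: "0 < e" "ball 0 e \<subseteq> I"
    using z unfolding open_contains_ball by (force simp: I_def)
  define p where "p = (\<lambda>t. f (z + t *\<^sub>R v))"
  define p' where "p' = (\<lambda>t. gradient f (z + t *\<^sub>R v) \<bullet> v)"
  have in_S: "z + t *\<^sub>R v \<in> S" if "t \<in> ball 0 e" for t
    using subsetD[OF e(2) that] interior_subset by (auto simp: I_def)
  have conv: "convex_on (ball 0 e) p"
  proof (rule convex_onI)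
    fix t a b :: real assume "0 < t" "t < 1" "a \<in> ball 0 e" "b \<in> ball 0 e"
    then show "p ((1 - t) *\<^sub>R a + t *\<^sub>R b) \<le> (1 - t) * p a + t * p b"
      using convex_onD[OF S(1), of t "z + a *\<^sub>R v" "z + b *\<^sub>R v"] in_S
      by (simp add: p_def algebra_simps)
  qed simp
  have DERIV: "(p has_real_derivative p' t) (at t)" if "t \<in> ball 0 e" for t
    unfolding p_def p'_def
    using in_S[OF that] S(2) by (intro C2_on_DERIV_along_line(1)[OF f]) auto
  have tangent: "p s - p t \<ge> p' t * (s - t)" if "s \<in> ball 0 e" "t \<in> ball 0 e" for s t
    using that DERIV[OF that(2)]
    by (intro convex_on_imp_above_tangent[OF conv]) (auto simp: interior_open intro: DERIV_subset)
  have "mono_on (ball 0 e) p'"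
  proof (rule mono_onI)
    fix s t :: real assume st: "s \<in> ball 0 e" "t \<in> ball 0 e" "s \<le> t"
    \<comment> \<open>This is the sum of the tangent inequalities at \<open>s\<close> and at
      \<open>t\<close>.\<close>
    have "0 \<le> (p' t - p' s) * (t - s)"
      using tangent[OF st(1,2)] tangent[OF st(2,1)] by (simp add: algebra_simps)
    then show "p' s \<le> p' t"
      using st(3) by (cases "s = t") (auto simp: zero_le_mult_iff)
  qed
  moreover have "z \<in> U" using z S(2) interior_subset by auto
  then have "(p' has_real_derivative v \<bullet> (hessian f z *v v)) (at 0)"
    using C2_on_DERIV_along_line(2)[OF f, of z 0 v] by (simp add: p'_def)
  ultimately show ?thesis
    using e(1) by (intro mono_on_imp_deriv_nonneg[of "ball 0 e" p' _ 0]) (auto simp: interior_open)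
qed

text \<open>A convex set with nonempty interior lies in the closure of that interior, so the
  inequality passes to boundary points by continuity of the Hessian.\<close>

lemma convex_on_hessian_nonneg:
  assumes f: "C2_on U f" and S: "convex_on S f" "S \<subseteq> U" "interior S \<noteq> {}" and z: "z \<in> S"
  shows "0 \<le> v \<bullet> (hessian f z *v v)"
proof -
  have "convex S" using S(1) by (rule convex_on_imp_convex)
  then have z': "z \<in> closure (interior S)"
    using z closure_subset convex_closure_interior[OF _ S(3)] by auto
  let ?F = "at z within interior S"
  show ?thesis
  proof (cases "z \<in> interior S")
    case True
    then show ?thesis using convex_on_hessian_nonneg_interior[OF f S(1,2)] by blast
  next
    case False
    have "continuous_on U (\<lambda>x. v \<bullet> (hessian f x *v v))"
      using f by (auto simp: C2_on_def matrix_vector_mult_def intro!: continuous_intros continuous_on_vec_lambda)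
    then have "continuous (at z within interior S) (\<lambda>x. v \<bullet> (hessian f x *v v))"
      using z S(2) interior_subset[of S] continuous_on_subset[of U _ S]
      by (metis continuous_on_eq_continuous_within continuous_within_subset)
    then have lim: "((\<lambda>x. v \<bullet> (hessian f x *v v)) \<longlongrightarrow> v \<bullet> (hessian f z *v v)) ?F"
      by (simp add: continuous_within)
    \<comment> \<open>A point of the closure that is not in the interior itself is a limit point of
      the interior, so the limit is not vacuous.\<close>
    have "?F \<noteq> bot"
      using z' False by (simp add: closure_def trivial_limit_within)
    moreover have "\<forall>\<^sub>F x in ?F. 0 \<le> v \<bullet> (hessian f x *v v)"
      using convex_on_hessian_nonneg_interior[OF f S(1,2)]
      by (auto simp: eventually_at_filter)
    ultimately show ?thesis by (intro tendsto_lowerbound[OF lim])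
  qed
qed

section \<open>Difference-of-convex decompositions\<close>

text \<open>Full dimensionality of \<open>X\<close> enters here: the relative interior of a nonempty
  convex set is nonempty, and it is the interior if the affine hull is the whole space.\<close>

lemma interior_nonempty_if_affine_hull_UNIV:
  fixes S :: "'a::euclidean_space set"
  assumes "convex S" "affine hull S = UNIV"
  shows "interior S \<noteq> {}"
  using assms rel_interior_interior[of S] rel_interior_eq_empty[of S] by auto

lemma C2_on_subset: "C2_on U f \<Longrightarrow> open T \<Longrightarrow> T \<subseteq> U \<Longrightarrow> C2_on T f"
  unfolding C2_on_def using continuous_on_subset by blast

lemma inner_vector_matrix_mult: "v \<bullet> (w v* A) = (A *v v) \<bullet> w"
  for A :: "real^'n^'m"
  by (metis dot_lmul_matrix inner_commute)

text \<open>All ranges lie in the range of \<open>transpose A\<close>, which is a linear image of a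
  space of dimension \<open>CARD('r)\<close>.\<close>

lemma hess_dim_le_if_range_transpose:
  fixes A :: "real^'n^'r"
  assumes "\<And>z. z \<in> convex hull X \<Longrightarrow> hessian g z = transpose A ** B z"
  shows "hess_dim X g \<le> CARD('r)"
proof -
  have "hess_space X g \<subseteq> range ((*v) (transpose A))"
    unfolding hess_space_def using assms
    by (intro span_minimal linear_subspace_image)
      (auto simp: matrix_vector_mul_assoc[symmetric])
  then have "hess_dim X g \<le> dim (range ((*v) (transpose A)))"
    unfolding hess_dim_def by (rule dim_subset)
  also have "\<dots> \<le> CARD('r)"
    using dim_image_le[of "(*v) (transpose A)" UNIV] by (simp add: dim_vec_eq)
  finally show ?thesis .
qed

text \<open>The bound holds for every decomposition and every point of the hull, boundary included,
  and so reaches the minimum. Symmetry of the Hessian is a hypothesis because the positive subspace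
  comes from diagonalization.\<close>

lemma dc_decomps_hess_dim_ge:
  assumes full: "affine hull X = UNIV" and gh: "(g, h) \<in> dc_decomps f X"
    and z: "z \<in> convex hull X" and sym: "transpose (hessian f z) = hessian f z"
  shows "num_pos_eigenvalues (hessian f z) \<le> hess_dim X g"
proof -
  obtain U where U: "convex hull X \<subseteq> U" "C2_on U g" "C2_on U h" "\<And>x. x \<in> U \<Longrightarrow> f x = g x - h x"
    and h: "convex_on (convex hull X) h"
    using gh by (auto simp: dc_decomps_def)
  have gh2: "C2_on U (\<lambda>x. g x - h x)"
    "\<And>x. x \<in> U \<Longrightarrow> hessian (\<lambda>x. g x - h x) x = hessian g x - hessian h x"
    using C2_on_diff[OF U(2,3)] by auto
  have "open U" using U(2) by (simp add: C2_on_def)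
  have zU: "z \<in> U" using U(1) z by blast
  \<comment> \<open>The equation f = g - h is known on \<open>U\<close> only; openness of
    \<open>U\<close> transfers the derivatives to \<open>f\<close>.\<close>
  have "C2_on U f \<and> (\<forall>x\<in>U. hessian f x = hessian g x - hessian h x)"
  proof (rule C2_on_and_hessianI[OF \<open>open U\<close>])
    fix x assume x: "x \<in> U"
    show "(f has_derivative (\<lambda>v. gradient (\<lambda>x. g x - h x) x \<bullet> v)) (at x)"
      by (rule has_derivative_transform_within_open[OF C2_on_has_derivative(1)[OF gh2(1) x] \<open>open U\<close> x])
        (simp add: U(4))
    show "(gradient (\<lambda>x. g x - h x) has_derivative (\<lambda>v. (hessian g x - hessian h x) *v v)) (at x)"
      using C2_on_has_derivative(2)[OF gh2(1) x] gh2(2)[OF x] by simp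
  qed (use U(2,3) in \<open>auto simp: C2_on_def intro!: continuous_intros\<close>)
  then have hess: "hessian g z = hessian f z + hessian h z"
    using zU by simp
  have h_nonneg: "0 \<le> v \<bullet> (hessian h z *v v)" for v
    using full by (intro convex_on_hessian_nonneg[OF U(3) h U(1) _ z]
        interior_nonempty_if_affine_hull_UNIV) (auto simp: convex_convex_hull)
  obtain W where W: "subspace W" "dim W = num_pos_eigenvalues (hessian f z)"
    "\<And>x. x \<in> W \<Longrightarrow> x \<noteq> 0 \<Longrightarrow> 0 < x \<bullet> (hessian f z *v x)"
    using symmetric_matrix_positive_subspace[OF sym] by blast
  have pos: "0 < x \<bullet> (hessian g z *v x)" if "x \<in> W" "x \<noteq> 0" for x
    using W(3)[OF that] h_nonneg[of x]
    by (simp add: hess matrix_vector_mult_add_rdistrib inner_add_right)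
  \<comment> \<open>A vector in the kernel has zero quadratic form, which positivity on
    \<open>W\<close> allows only for the zero vector.\<close>
  have "inj_on ((*v) (hessian g z)) W"
  proof (rule inj_onI)
    fix x y assume xy: "x \<in> W" "y \<in> W" "hessian g z *v x = hessian g z *v y"
    then have "hessian g z *v (x - y) = 0"
      by (simp add: matrix_vector_mult_diff_distrib)
    then show "x = y"
      using pos[of "x - y"] subspace_diff[OF W(1) xy(1,2)] by force
  qed
  then have "dim W = dim ((*v) (hessian g z) ` W)"
    using W(1) by (simp add: dim_image_eq span_eq_iff[THEN iffD2])
  also have "\<dots> \<le> hess_dim X g"
    unfolding hess_dim_def hess_space_def using z by (intro dim_subset) (auto intro!: span_base)
  finally show ?thesis by (simp add: W(2))
qed

section \<open>Upper and lower bounds for \<open>dstar\<close>\<close>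

theorem proposition5p3:
  fixes X :: "(real^'n) set" and A :: "real^'n^'r" and \<phi> :: "real^'r \<Rightarrow> real"
    and q f :: "real^'n \<Rightarrow> real" and L :: real
  assumes "compact X" and "affine hull X = UNIV"
    and "rank A = CARD('r)"
    and "C2_near ((\<lambda>x. A *v x) ` (convex hull X)) \<phi>"
    and "quadratic_function q" and "concave_on UNIV q"
    and "\<And>x. f x = \<phi> (A *v x) + q x"
    and "0 \<le> L"
    and "\<And>u. u \<in> (\<lambda>x. A *v x) ` (convex hull X) \<Longrightarrow> hessian \<phi> u \<preceq>\<^sub>L L *\<^sub>R mat 1"
  shows "dstar f X \<le> CARD('r)
    \<and> ((\<exists>z \<in> convex hull X. CARD('r) \<le> num_pos_eigenvalues (hessian f z))
         \<longrightarrow> dstar f X = CARD('r))"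
proof -
  note full = assms(2) and concave = assms(6) and f_def = assms(7) and loewner = assms(9)
  let ?S = "convex hull X"
  obtain V where V: "(\<lambda>x. A *v x) ` ?S \<subseteq> V" "C2_on V \<phi>"
    using assms(4) by (auto simp: C2_near_def)
  define U where "U = (\<lambda>x. A *v x) -` V"
  have SU: "?S \<subseteq> U" using V(1) by (auto simp: U_def)
  have \<phi>A: "C2_on U (\<lambda>x. \<phi> (A *v x))"
    "\<And>x. x \<in> U \<Longrightarrow> hessian (\<lambda>x. \<phi> (A *v x)) x = transpose A ** (hessian \<phi> (A *v x) ** A)"
    using C2_on_compose_linear[OF V(2), of A] by (auto simp: U_def)
  have "open U" using \<phi>A(1) by (simp add: C2_on_def)
  obtain Q b c where Q: "transpose Q = Q" and q: "q = (\<lambda>x. x \<bullet> (Q *v x) + b \<bullet> x + c)"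
    using assms(5) by (auto simp: quadratic_function_def fun_eq_iff)
  have q2: "C2_on U q" "\<And>x. hessian q x = 2 *\<^sub>R Q"
    using C2_on_quadratic[OF Q, of b c] C2_on_subset[OF _ \<open>open U\<close>] by (auto simp: q)
  \<comment> \<open>Apply the second-order condition to the convex function -q. Its Hessian is
    constant, so evaluating it at 0 suffices.\<close>
  have Q_nonpos: "v \<bullet> (Q *v v) \<le> 0" for v
  proof -
    have minus: "(- M) *v x = - (M *v x)" for M :: "real^'n^'n" and x
      by (simp add: vec_eq_iff matrix_vector_mult_def sum_negf)
    have "transpose (- Q) = - Q"
      using Q by (simp add: vec_eq_iff transpose_def)
    then have Q': "C2_on UNIV (\<lambda>x. - q x)" "hessian (\<lambda>x. - q x) 0 = 2 *\<^sub>R (- Q)"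
      using C2_on_quadratic[of "- Q" "- b" "- c"] by (auto simp: q minus algebra_simps)
    have "0 \<le> v \<bullet> (hessian (\<lambda>x. - q x) 0 *v v)"
      using concave by (intro convex_on_hessian_nonneg[OF Q'(1)]) (auto simp: concave_on_def)
    then show ?thesis
      by (simp add: Q'(2) minus flip: scaleR_matrix_vector_assoc)
  qed
  have f2: "C2_on U f"
    "\<And>x. x \<in> U \<Longrightarrow> hessian f x = transpose A ** (hessian \<phi> (A *v x) ** A) + 2 *\<^sub>R Q"
  proof -
    have "f = (\<lambda>x. \<phi> (A *v x) + q x)" using f_def by (rule ext)
    then show "C2_on U f"
      "\<And>x. x \<in> U \<Longrightarrow> hessian f x = transpose A ** (hessian \<phi> (A *v x) ** A) + 2 *\<^sub>R Q"
      using C2_on_add[OF \<phi>A(1) q2(1)] by (simp_all add: \<phi>A(2) q2(2))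
  qed
  \<comment> \<open>The factor L / 2 offsets the 2 in the Hessian of a quadratic form, so that
    \<open>g\<close> has Hessian L times \<open>transpose A ** A\<close>.\<close>
  define G where "G = transpose A ** ((L / 2) *\<^sub>R A)"
  have G: "transpose G = G"
    by (simp add: G_def matrix_transpose_mul vec_eq_iff transpose_def matrix_matrix_mult_def mult_ac)
  define g where "g = (\<lambda>x. x \<bullet> (G *v x) + 0 \<bullet> x + 0)"
  have g2: "C2_on U g" "\<And>x. hessian g x = 2 *\<^sub>R G"
    using C2_on_quadratic[OF G, of 0 0] C2_on_subset[OF _ \<open>open U\<close>] by (auto simp: g_def)
  have G_quad: "v \<bullet> (hessian g x *v v) = L * ((A *v v) \<bullet> (A *v v))" for x v
    by (simp add: g2(2) G_def inner_vector_matrix_mult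
        flip: scaleR_matrix_vector_assoc matrix_vector_mul_assoc)
  define h where "h = (\<lambda>x. g x - f x)"
  have h2: "C2_on U h" "\<And>x. x \<in> U \<Longrightarrow> hessian h x = hessian g x - hessian f x"
    using C2_on_diff[OF g2(1) f2(1)] unfolding h_def by blast+
  have g_convex: "convex_on ?S g"
    using \<open>0 \<le> L\<close> by (intro convex_on_if_hessian_nonneg[OF g2(1) _ SU]) (auto simp: G_quad)
  have h_convex: "convex_on ?S h"
  proof (rule convex_on_if_hessian_nonneg[OF h2(1) _ SU])
    fix z v assume z: "z \<in> ?S"
    have "psd (L *\<^sub>R mat 1 - hessian \<phi> (A *v z))"
      using loewner[of "A *v z"] z by (simp add: loewner_le_def)
    \<comment> \<open>Testing the Loewner bound on \<open>A *v v\<close> pulls it back along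
      \<open>A\<close>. The concave part then adds the nonnegative term -2
      \<open>v \<bullet> (Q *v v)\<close> to the form of \<open>h\<close>.\<close>
    then have "0 \<le> (A *v v) \<bullet> ((L *\<^sub>R mat 1 - hessian \<phi> (A *v z)) *v (A *v v))"
      by (simp add: psd_def)
    then have "(A *v v) \<bullet> (hessian \<phi> (A *v z) *v (A *v v)) \<le> L * ((A *v v) \<bullet> (A *v v))"
      by (simp add: matrix_vector_mult_diff_rdistrib inner_diff_right flip: scaleR_matrix_vector_assoc)
    then show "0 \<le> v \<bullet> (hessian h z *v v)"
      using Q_nonpos[of v] z SU
      by (simp add: h2(2) f2(2) subset_iff matrix_vector_mult_diff_rdistrib matrix_vector_mult_add_rdistrib
          inner_diff_right inner_add_right G_quad inner_vector_matrix_mult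
          flip: scaleR_matrix_vector_assoc matrix_vector_mul_assoc)
  qed (simp add: convex_convex_hull)
  have gh: "(g, h) \<in> dc_decomps f X"
    using SU g2(1) h2(1) g_convex h_convex unfolding dc_decomps_def by (auto simp: h_def)
  have "hessian g z = transpose A ** (L *\<^sub>R A)" for z
    by (simp add: g2(2) G_def vec_eq_iff matrix_matrix_mult_def sum_distrib_left)
  then have g_dim: "hess_dim X g \<le> CARD('r)"
    by (rule hess_dim_le_if_range_transpose)
  let ?D = "{hess_dim X g | g h. (g, h) \<in> dc_decomps f X}"
  have "finite ?D" by (rule finite_hess_dims)
  have "dstar f X \<le> hess_dim X g"
    unfolding dstar_def using gh by (intro Min_le[OF \<open>finite ?D\<close>]) blast
  then have upper: "dstar f X \<le> CARD('r)" using g_dim by simp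
  \<comment> \<open>The pair \<open>(g, h)\<close> makes the set nonempty, so its minimum is
    attained by an actual decomposition, to which the lower bound can be applied.\<close>
  have "dstar f X \<in> ?D"
    unfolding dstar_def using gh by (intro Min_in[OF \<open>finite ?D\<close>]) blast
  then obtain g' h' where g': "(g', h') \<in> dc_decomps f X" "dstar f X = hess_dim X g'"
    by blast
  have "dstar f X = CARD('r)" if z: "z \<in> ?S" "CARD('r) \<le> num_pos_eigenvalues (hessian f z)" for z
  proof -
    \<comment> \<open>Symmetry of the Hessian of \<open>f\<close> is read off from the Loewner
      bound: \<open>psd\<close> includes symmetry, so the Hessian of \<phi> at \<open>A *v z\<close>
      is symmetric, and both its congruence by \<open>A\<close> and \<open>Q\<close> are
      symmetric.\<close>
    have "transpose (L *\<^sub>R mat 1 - M) = L *\<^sub>R mat 1 - transpose M" for M :: "real^'r^'r"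
      by (auto simp: vec_eq_iff transpose_def mat_def)
    moreover have "transpose (L *\<^sub>R mat 1 - hessian \<phi> (A *v z)) = L *\<^sub>R mat 1 - hessian \<phi> (A *v z)"
      using loewner[of "A *v z"] z(1) by (simp add: loewner_le_def psd_def)
    ultimately have "transpose (hessian \<phi> (A *v z)) = hessian \<phi> (A *v z)"
      by simp
    moreover have "transpose (B + 2 *\<^sub>R C) = transpose B + 2 *\<^sub>R transpose C" for B C :: "real^'n^'n"
      by (simp add: vec_eq_iff transpose_def)
    ultimately have "transpose (hessian f z) = hessian f z"
      using z(1) SU Q by (simp add: f2(2) subset_iff matrix_transpose_mul matrix_mul_assoc)
    from dc_decomps_hess_dim_ge[OF full g'(1) z(1) this] show ?thesis
      using z(2) g'(2) upper by simp
  qed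
  with upper show ?thesis by blast
qed

end
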